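(* Let $k\ge1$ and $n$ be integers and let $1\le s_1<s_2<\ldots<s_k<\frac{n}{2}$ be integers. Let $G=C_n(s_1,\ldots,s_k)$ be the circulant graph and $\widetilde{G}$ the cone over $G$. Then $Jac(\widetilde{G})$ is isomorphic to $\mathrm{coker}(\mathcal{A}^n-I)$, where $\mathcal{A}$ is the companion matrix of the Laurent polynomial $2k+1-\sum_{l=1}^{k}(z^{s_l}+z^{-s_l})$ and $I$ is the identity matrix of the same size as $\mathcal{A}$.
   Context: The circulant graph $C_n(s_1,\ldots,s_k)$ has vertices $0,1,\ldots,n-1$, with vertex $i$ adjacent to $i\pm s_1,\ldots,i\pm s_k \pmod n$. The cone over a graph $G$ is obtained by adding a new vertex joined by a single edge to every vertex of $G$. For a connected graph $H$ on $m$ vertices with Laplacian $L(H)=D(H)-A(H)$ (degree matrix minus adjacency matrix), the Jacobian $Jac(H)$ is the torsion subgroup of $\mathbb{Z}^m/\mathrm{im}\,L(H)$. For a Laurent polynomial $Q(z)=c\,(z^{p}+a_1z^{p+1}+\ldots+a_{s-1}z^{p+s-1}+z^{p+s})$ with $c\in\{1,-1\}$, integers $p,a_i$ and $s>0$, its companion matrix is the $s\times s$ integer matrix whose first $s-1$ rows are $(0\mid I_{s-1})$ and whose last row is $(-1,-a_1,\ldots,-a_{s-1})$. For a square integer matrix $M$ of size $s$, $\mathrm{coker}\,M=\mathbb{Z}^s/\mathrm{im}\,M$. *)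

theory Defs
  imports
    Complex_Main
    "HOL-Algebra.Algebra"
    "HOL-Number_Theory.Cong"
    "HOL-Library.Poly_Mapping"
    "Graph_Theory.Pair_Digraph"
    "Jordan_Normal_Form.Matrix"
begin

section \<open>Circulant graphs and cones\<close>

text \<open>
  A simple graph is a pair digraph satisfying the locale \<^locale>\<open>pair_graph\<close>: finite, loop-free and
  with a symmetric arc relation. The jumps of a circulant graph are
  \<open>s 1, \<dots>, s k\<close>; other values of \<open>s\<close> play no role.
\<close>

definition circulant_graph :: "nat \<Rightarrow> nat \<Rightarrow> (nat \<Rightarrow> nat) \<Rightarrow> nat pair_pre_digraph" where
  "circulant_graph n k s =
     \<lparr> pverts = {0..<n},
       parcs = {(i, j). i < n \<and> j < n \<and>
         (\<exists>l\<in>{1..k}. [int j = int i + int (s l)] (mod int n) \<or>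
                     [int j = int i - int (s l)] (mod int n))} \<rparr>"

text \<open>
  For a graph on the vertices \<open>0, \<dots>, n - 1\<close> the apex of the cone is the vertex \<open>n\<close>.
\<close>

definition cone_graph :: "nat pair_pre_digraph \<Rightarrow> nat pair_pre_digraph" where
  "cone_graph G = (let v = card (pverts G) in
     \<lparr> pverts = insert v (pverts G),
       parcs = parcs G \<union> {v} \<times> pverts G \<union> pverts G \<times> {v} \<rparr>)"

lemma pair_graph_circulant:
  assumes "\<And>l. l \<in> {1..k} \<Longrightarrow> 1 \<le> s l \<and> s l < n"
  shows "pair_graph (circulant_graph n k s)"
proof
  let ?G = "circulant_graph n k s"
  show "finite (pverts ?G)" by (simp add: circulant_graph_def)
  show "finite (parcs ?G)"
    by (rule finite_subset[of _ "{0..<n} \<times> {0..<n}"]) (auto simp: circulant_graph_def)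
  show "fst e \<in> pverts ?G" if "e \<in> parcs ?G" for e
    using that by (auto simp: circulant_graph_def)
  show "snd e \<in> pverts ?G" if "e \<in> parcs ?G" for e
    using that by (auto simp: circulant_graph_def)
  show "fst e \<noteq> snd e" if e: "e \<in> parcs ?G" for e
  proof
    assume "fst e = snd e"
    with e obtain l where l: "l \<in> {1..k}" and "int n dvd int (s l)"
      by (auto simp: circulant_graph_def cong_iff_dvd_diff)
    then have "n dvd s l" by simp
    with assms[OF l] show False by (auto dest: dvd_imp_le)
  qed
  have "(j, i) \<in> parcs ?G" if "(i, j) \<in> parcs ?G" for i j
  proof -
    from that obtain l where l: "l \<in> {1..k}" and ij: "i < n" "j < n"
      and d: "int n dvd int j - (int i + int (s l)) \<or> int n dvd int j - (int i - int (s l))"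
      by (auto simp: circulant_graph_def cong_iff_dvd_diff)
    have "- (int j - (int i + int (s l))) = int i - (int j - int (s l))"
         "- (int j - (int i - int (s l))) = int i - (int j + int (s l))" by simp_all
    with d have "int n dvd int i - (int j - int (s l)) \<or> int n dvd int i - (int j + int (s l))"
      by (metis dvd_minus_iff)
    with l ij show ?thesis by (auto simp: circulant_graph_def cong_iff_dvd_diff)
  qed
  then show "symmetric (with_proj ?G)"
    by (auto simp: symmetric_def intro: symI)
qed

lemma pair_graph_cone_graph:
  assumes "pair_graph G" "pverts G = {0..<n}"
  shows "pair_graph (cone_graph G)"
proof -
  interpret pair_graph G by fact
  have s: "sym (parcs G)"
    using pair_sym_arcs by (simp add: symmetric_def)
  show ?thesis
  proof
    show "symmetric (with_proj (cone_graph G))"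
      using s by (auto simp: symmetric_def cone_graph_def Let_def sym_def)
  qed (use assms(2) pair_finite_arcs wellformed' pair_no_loops in
        \<open>auto simp: cone_graph_def Let_def\<close>)
qed


section \<open>Laplacian, cokernel and Jacobian\<close>

text \<open>The following matrices refer to graphs whose vertex set is \<open>{0..<m}\<close>.\<close>

definition degree_matrix :: "nat pair_pre_digraph \<Rightarrow> int mat" where
  "degree_matrix H = (let m = card (pverts H) in
     mat m m (\<lambda>(i, j). if i = j then int (out_degree (with_proj H) i) else 0))"

definition adjacency_matrix :: "nat pair_pre_digraph \<Rightarrow> int mat" where
  "adjacency_matrix H = (let m = card (pverts H) in
     mat m m (\<lambda>(i, j). if (i, j) \<in> parcs H then 1 else 0))"

definition laplacian :: "nat pair_pre_digraph \<Rightarrow> int mat" where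
  "laplacian H = degree_matrix H - adjacency_matrix H"

definition mat_image :: "int mat \<Rightarrow> int vec set" where
  "mat_image M = (\<lambda>v. M *\<^sub>v v) ` carrier_vec (dim_col M)"

definition coker :: "int mat \<Rightarrow> int vec set monoid" where
  "coker M = monoid_vec TYPE(int) (dim_row M) Mod mat_image M"

definition torsion_group :: "('a, 'b) monoid_scheme \<Rightarrow> ('a, 'b) monoid_scheme" where
  "torsion_group G =
     G\<lparr>carrier := {x \<in> carrier G. \<exists>m::nat. m > 0 \<and> x [^]\<^bsub>G\<^esub> m = \<one>\<^bsub>G\<^esub>}\<rparr>"

definition Jac :: "nat pair_pre_digraph \<Rightarrow> int vec set monoid" where
  "Jac H = torsion_group (coker (laplacian H))"

lemma comm_group_coker: "comm_group (coker M)"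
proof -
  interpret V: comm_group "monoid_vec TYPE(int) (dim_row M)" by (rule comm_group_vec)
  have "subgroup (mat_image M) (monoid_vec TYPE(int) (dim_row M))"
  proof (rule V.subgroupI)
    show "mat_image M \<subseteq> carrier (monoid_vec TYPE(int) (dim_row M))"
      by (auto simp: mat_image_def monoid_vec_simps intro: mult_mat_vec_carrier[of M])
    show "mat_image M \<noteq> {}"
      unfolding mat_image_def using zero_carrier_vec by blast
  next
    fix a assume "a \<in> mat_image M"
    then obtain v where v: "v \<in> carrier_vec (dim_col M)" "a = M *\<^sub>v v"
      by (auto simp: mat_image_def)
    have M: "M \<in> carrier_mat (dim_row M) (dim_col M)" by simp
    have "M *\<^sub>v (- v) + a = M *\<^sub>v (- v + v)"
      using v mult_add_distrib_mat_vec[OF M, of "- v" v] by simp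
    also have "- v + v = 0\<^sub>v (dim_col M)" using v by simp
    also have "M *\<^sub>v 0\<^sub>v (dim_col M) = 0\<^sub>v (dim_row M)" by auto
    finally have "inv\<^bsub>monoid_vec TYPE(int) (dim_row M)\<^esub> a = M *\<^sub>v (- v)"
      using v mult_mat_vec_carrier[OF M, of v] mult_mat_vec_carrier[OF M, of "- v"]
      by (intro V.inv_equality) (simp_all add: monoid_vec_simps)
    then show "inv\<^bsub>monoid_vec TYPE(int) (dim_row M)\<^esub> a \<in> mat_image M"
      using v by (auto simp: mat_image_def)
  next
    fix a b assume "a \<in> mat_image M" "b \<in> mat_image M"
    then obtain v w where vw: "v \<in> carrier_vec (dim_col M)" "a = M *\<^sub>v v"
      "w \<in> carrier_vec (dim_col M)" "b = M *\<^sub>v w"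
      by (auto simp: mat_image_def)
    have M: "M \<in> carrier_mat (dim_row M) (dim_col M)" by simp
    have "a + b = M *\<^sub>v (v + w)"
      using vw mult_add_distrib_mat_vec[OF M, of v w] by simp
    then show "a \<otimes>\<^bsub>monoid_vec TYPE(int) (dim_row M)\<^esub> b \<in> mat_image M"
      using vw by (auto simp: mat_image_def monoid_vec_simps)
  qed
  then show ?thesis
    unfolding coker_def by (rule V.abelian_FactGroup)
qed


section \<open>Laurent polynomials and companion matrices\<close>

text \<open>
  Integer Laurent polynomials are the finitely supported maps from exponents to coefficients,
  with the convolution product.
\<close>

type_synonym laurent_poly = "int \<Rightarrow>\<^sub>0 int"

abbreviation zpow :: "int \<Rightarrow> laurent_poly" where
  "zpow e \<equiv> Poly_Mapping.single e 1"

text \<open>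
  For \<open>Q = c (z^p + a\<^sub>1 z^(p+1) + \<dots> + z^(p+d))\<close> with \<open>c \<in> {1, -1}\<close>, the coefficients \<open>a\<^sub>j\<close> are
  recovered by multiplying by \<open>c\<close>, since \<open>c * c = 1\<close>; in particular \<open>a 0 = 1\<close> below gives the
  entry \<open>-1\<close> at the start of the last row. For \<open>Q\<close> not of this shape the value is irrelevant.
\<close>

definition companion_matrix :: "laurent_poly \<Rightarrow> int mat" where
  "companion_matrix Q =
     (let p = Min (Poly_Mapping.keys Q);
          d = nat (Max (Poly_Mapping.keys Q) - p);
          c = Poly_Mapping.lookup Q p;
          a = (\<lambda>j::nat. c * Poly_Mapping.lookup Q (p + int j))
      in mat d d (\<lambda>(i, j).
           if i + 1 < d then (if j = i + 1 then 1 else 0) else - a j))"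

lemma companion_matrix_bimonic:
  fixes c p :: int and a :: "nat \<Rightarrow> int" and d :: nat
  assumes c: "c \<in> {1, -1}" and d: "d > 0" and a: "a 0 = 1" "a d = 1"
  shows "companion_matrix (\<Sum>j\<le>d. Poly_Mapping.single (p + int j) (c * a j)) =
    mat d d (\<lambda>(i, j). if i + 1 < d then (if j = i + 1 then 1 else 0) else - a j)"
proof -
  define Q where "Q = (\<Sum>j\<le>d. Poly_Mapping.single (p + int j) (c * a j))"
  have look: "Poly_Mapping.lookup Q e =
      (if p \<le> e \<and> e \<le> p + int d then c * a (nat (e - p)) else 0)" for e
  proof -
    have "Poly_Mapping.lookup Q e = (\<Sum>j\<le>d. if nat (e - p) = j \<and> p \<le> e then c * a j else 0)"
      unfolding Q_def lookup_sum
      by (intro sum.cong) (auto simp: lookup_single when_def)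
    then show ?thesis by (cases "p \<le> e") auto
  qed
  have keys: "Poly_Mapping.keys Q \<subseteq> {p..p + int d}"
    by (auto simp: in_keys_iff look split: if_splits)
  have mn: "Min (Poly_Mapping.keys Q) = p"
    by (rule Min_eqI) (use keys c a in \<open>auto simp: in_keys_iff look\<close>)
  have mx: "Max (Poly_Mapping.keys Q) = p + int d"
    by (rule Max_eqI) (use keys c a in \<open>auto simp: in_keys_iff look\<close>)
  have "c * (c * x) = x" for x using c by auto
  then show ?thesis
    unfolding Q_def[symmetric] companion_matrix_def Let_def mn mx
    by (intro eq_matI) (use a in \<open>auto simp: look\<close>)
qed

end

(* Deleting the apex row and column turns the Laplacian of the cone into the circulant matrix Q(T), where
   Q is the Laurent polynomial of the statement and T the cyclic shift. Since Q(1) = 1, the all-ones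
   vector is fixed by Q(T); hence the image of the Laplacian consists of the vectors of coordinate sum 0
   whose first n entries lie in the image of Q(T). As Q(T) is strictly diagonally dominant, its cokernel
   is finite, so the torsion classes are exactly those of coordinate sum 0, and the Jacobian is the
   cokernel of Q(T), that is Z[z]/(P, z^n - 1) with P = -z^(s_k) Q monic. The companion matrix A acts
   on Z^d, d = deg P, with cyclic vector e_(d-1), and f |-> f(A) e_(d-1) identifies Z[z]/(P) with Z^d and
   (z^n - 1) with the image of A^n - I. *)
theory Submission
  imports Defs "Jordan_Normal_Form.Determinant"
begin

hide_const (open) up_ring.coeff up_ring.monom Module.smult

section \<open>Companion matrices and quotients of polynomial rings\<close>

text \<open>The same last row as in \<open>companion_matrix\<close>, but read off an ordinary
  polynomial, so that divisibility by \<open>P\<close> can be used;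
  \<open>companion_matrix_jump\<close> links the two.\<close>

definition companion :: "'a::comm_ring_1 poly \<Rightarrow> 'a mat" where
  "companion P = (let d = degree P in
     mat d d (\<lambda>(i, j). if i + 1 < d then (if j = i + 1 then 1 else 0) else - coeff P j))"

lemma companion_carrier [simp]: "companion P \<in> carrier_mat (degree P) (degree P)"
  and dim_row_companion [simp]: "dim_row (companion P) = degree P"
  and dim_col_companion [simp]: "dim_col (companion P) = degree P"
  by (simp_all add: companion_def Let_def)

lemma index_companion_mult_vec:
  assumes "w \<in> carrier_vec (degree P)" "i < degree P"
  shows "(companion P *\<^sub>v w) $ i =
    (if i + 1 < degree P then w $ (i + 1) else - (\<Sum>j<degree P. coeff P j * w $ j))"
proof (cases "i + 1 < degree P")
  case True
  then have "(companion P *\<^sub>v w) $ i = (\<Sum>j<degree P. (if j = i + 1 then 1 else 0) * w $ j)"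
    using assms by (auto simp: companion_def Let_def scalar_prod_def atLeast0LessThan intro!: sum.cong)
  also have "\<dots> = (\<Sum>j<degree P. if j = i + 1 then w $ j else 0)"
    by (intro sum.cong) auto
  finally show ?thesis using True by simp
next
  case False
  with assms show ?thesis
    by (auto simp: companion_def Let_def scalar_prod_def atLeast0LessThan
        sum_negf[symmetric] intro!: sum.cong)
qed

text \<open>\<open>krylov P f\<close> is \<open>f\<close> evaluated at the companion matrix (by Horner's rule), applied to the last
  unit vector, which is a cyclic vector.\<close>

definition krylov :: "'a::comm_ring_1 poly \<Rightarrow> 'a poly \<Rightarrow> 'a vec" where
  "krylov P f = fold_coeffs
     (\<lambda>c w. c \<cdot>\<^sub>v unit_vec (degree P) (degree P - 1) + companion P *\<^sub>v w) f (0\<^sub>v (degree P))"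

lemma krylov_0 [simp]: "krylov P 0 = 0\<^sub>v (degree P)"
  by (simp add: krylov_def)

lemma krylov_pCons:
  "krylov P (pCons c f) =
     c \<cdot>\<^sub>v unit_vec (degree P) (degree P - 1) + companion P *\<^sub>v krylov P f"
proof (cases "c = 0 \<and> f = 0")
  \<comment> \<open>\<open>fold_coeffs\<close> sees no coefficient in \<open>pCons 0 0\<close>, so
    this case is separate; both sides are zero.\<close>
  case True
  then show ?thesis by (intro eq_vecI) (auto simp: scalar_prod_def)
next
  case False
  then show ?thesis by (cases "c = 0") (auto simp: krylov_def)
qed

lemma krylov_carrier [simp]: "krylov P f \<in> carrier_vec (degree P)"
proof (induction f)
  case (pCons c f)
  then show ?case
    using mult_mat_vec_carrier[OF companion_carrier[of P] pCons.IH] by (simp add: krylov_pCons)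
qed simp

lemma dim_krylov [simp]: "dim_vec (krylov P f) = degree P"
  using krylov_carrier by (rule carrier_vecD)

lemma krylov_add: "krylov P (f + g) = krylov P f + krylov P g"
proof (induction f g rule: poly_induct2)
  case (pCons a p b q)
  then show ?case
    by (auto simp: krylov_pCons mult_add_distrib_mat_vec[OF companion_carrier] algebra_simps
        intro!: eq_vecI)
qed simp

lemma krylov_smult: "krylov P (Polynomial.smult c f) = c \<cdot>\<^sub>v krylov P f"
proof (induction f)
  case (pCons a f)
  show ?case
    by (intro eq_vecI)
      (auto simp: krylov_pCons pCons.IH scalar_prod_def sum_distrib_left algebra_simps)
qed auto

lemma krylov_diff: "krylov P (f - g) = krylov P f - krylov P g"
proof -
  have "krylov P (f + Polynomial.smult (- 1) g) = krylov P f - krylov P g"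
    unfolding krylov_add krylov_smult by (intro eq_vecI) auto
  then show ?thesis by simp
qed

lemma index_krylov_sum:
  assumes "finite S" "j < degree P"
  shows "krylov P (\<Sum>i\<in>S. f i) $ j = (\<Sum>i\<in>S. krylov P (f i) $ j)"
  using assms(1) by (induction S) (use assms(2) in \<open>auto simp: krylov_add\<close>)

text \<open>In Horner's rule a new zero coefficient at the bottom just applies
  \<open>companion P\<close> once, so multiplication by \<open>X\<close> turns into the companion
  matrix.\<close>

lemma krylov_monom_mult: "krylov P (monom 1 m * f) = companion P ^\<^sub>m m *\<^sub>v krylov P f"
proof (induction m arbitrary: f)
  case (Suc m)
  have "monom 1 (Suc m) * f = monom 1 m * pCons 0 f"
    by (simp add: monom_Suc)
  then have "krylov P (monom 1 (Suc m) * f) = companion P ^\<^sub>m m *\<^sub>v krylov P (pCons 0 f)"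
    by (simp only: Suc.IH)
  also have "krylov P (pCons 0 f) = companion P *\<^sub>v krylov P f"
    unfolding krylov_pCons by (intro eq_vecI) auto
  also have "companion P ^\<^sub>m m *\<^sub>v \<dots> = companion P ^\<^sub>m Suc m *\<^sub>v krylov P f"
    unfolding pow_mat.simps
    by (rule assoc_mult_mat_vec[OF pow_carrier_mat[OF companion_carrier] companion_carrier krylov_carrier,
        symmetric])
  finally show ?case .
qed simp

text \<open>The coefficients are the Horner polynomials of \<open>P\<close>, which \<open>krylov P\<close> maps to the unit vectors.
  For monic \<open>P\<close>, \<open>krylov_inv P (krylov P f)\<close> is the remainder of \<open>f\<close> modulo \<open>P\<close>.\<close>

definition krylov_inv :: "'a::comm_ring_1 poly \<Rightarrow> 'a vec \<Rightarrow> 'a poly" where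
  "krylov_inv P w = (\<Sum>j<degree P. Polynomial.smult (w $ j) (poly_shift (Suc j) P))"

section \<open>Horner polynomials and division by a monic polynomial\<close>

lemma poly_shift_unfold: "poly_shift j P = pCons (coeff P j) (poly_shift (Suc j) P)"
  by (auto simp: poly_eq_iff coeff_poly_shift coeff_pCons split: nat.splits)

lemma poly_shift_degree: "poly_shift (degree P) P = [:lead_coeff P:]"
  by (auto simp: poly_eq_iff coeff_poly_shift coeff_pCons coeff_eq_0 split: nat.splits)

context
  fixes P :: "'a::comm_ring_1 poly"
  assumes monic: "lead_coeff P = 1" and degree_pos: "degree P > 0"
begin

text \<open>Induction downwards from the top Horner polynomial, the constant 1. The companion matrix
  sends unit vector \<open>j > 0\<close> to unit vector \<open>j - 1\<close> minus
  \<open>coeff P j\<close> times the last one, and the coefficient added by the next Horner step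
  cancels that last term.\<close>

lemma krylov_poly_shift:
  assumes "j < degree P"
  shows "krylov P (poly_shift (Suc j) P) = unit_vec (degree P) j"
proof -
  have "i < degree P \<Longrightarrow>
    krylov P (poly_shift (degree P - i) P) = unit_vec (degree P) (degree P - Suc i)" for i
  proof (induction i)
    case 0
    then show ?case
      unfolding diff_zero poly_shift_degree monic krylov_pCons
      by (intro eq_vecI) (auto simp: scalar_prod_def)
  next
    case (Suc i)
    let ?j = "degree P - Suc i"
    have j: "?j > 0" "?j < degree P" "Suc ?j = degree P - i" using Suc.prems by auto
    have "krylov P (poly_shift ?j P) =
        coeff P ?j \<cdot>\<^sub>v unit_vec (degree P) (degree P - 1) +
        companion P *\<^sub>v unit_vec (degree P) ?j"
      using Suc j by (subst poly_shift_unfold) (simp add: krylov_pCons)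
    also have "\<dots> = unit_vec (degree P) (?j - 1)"
    proof (intro eq_vecI)
      fix r assume "r < dim_vec (unit_vec (degree P) (?j - 1))"
      then have r: "r < degree P" by simp
      have "r < degree P - 1 \<or> r = degree P - 1" using r by auto
      then show "(coeff P ?j \<cdot>\<^sub>v unit_vec (degree P) (degree P - 1) +
        companion P *\<^sub>v unit_vec (degree P) ?j) $ r = unit_vec (degree P) (?j - 1) $ r"
        using r j Suc.prems by (auto simp: companion_def Let_def)
    qed auto
    finally show ?case by simp
  qed
  from this[of "degree P - Suc j"] assms show ?thesis by (simp add: Suc_diff_Suc)
qed

text \<open>The final Horner step: \<open>companion P\<close> sends unit vector 0 to
  \<open>- coeff P 0\<close> times the last one, and the constant term of \<open>P\<close> cancels
  it. This is Cayley-Hamilton on the cyclic vector.\<close>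

lemma krylov_self: "krylov P P = 0\<^sub>v (degree P)"
proof -
  have "krylov P P = coeff P 0 \<cdot>\<^sub>v unit_vec (degree P) (degree P - 1) +
        companion P *\<^sub>v unit_vec (degree P) 0"
    using krylov_poly_shift[OF degree_pos] poly_shift_unfold[of 0 P] krylov_pCons
    by (metis poly_shift_id)
  also have "\<dots> = 0\<^sub>v (degree P)"
  proof (intro eq_vecI)
    fix r assume "r < dim_vec (0\<^sub>v (degree P) :: 'a vec)"
    then have r: "r < degree P" by simp
    have "r < degree P - 1 \<or> r = degree P - 1" using r by auto
    then show "(coeff P 0 \<cdot>\<^sub>v unit_vec (degree P) (degree P - 1) +
        companion P *\<^sub>v unit_vec (degree P) 0) $ r = 0\<^sub>v (degree P) $ r"
      using r degree_pos by (auto simp: companion_def Let_def)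
  qed auto
  finally show ?thesis .
qed

lemma krylov_mult_self: "krylov P (P * g) = 0\<^sub>v (degree P)"
proof (induction g)
  case (pCons c g)
  have "P * pCons c g = Polynomial.smult c P + pCons 0 (P * g)"
    by simp
  then have "krylov P (P * pCons c g) = c \<cdot>\<^sub>v krylov P P + krylov P (pCons 0 (P * g))"
    by (simp add: krylov_add krylov_smult)
  also have "\<dots> = 0\<^sub>v (degree P)"
    unfolding krylov_self krylov_pCons pCons.IH
    by (intro eq_vecI) (auto simp: scalar_prod_def)
  finally show ?case .
qed simp

lemma krylov_krylov_inv:
  assumes "w \<in> carrier_vec (degree P)"
  shows "krylov P (krylov_inv P w) = w"
proof (intro eq_vecI)
  fix r assume "r < dim_vec w"
  then have r: "r < degree P" using assms by simp
  have "krylov P (krylov_inv P w) $ r = (\<Sum>j<degree P. w $ j * unit_vec (degree P) j $ r)"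
    unfolding krylov_inv_def using r
    by (simp add: index_krylov_sum krylov_smult krylov_poly_shift)
  also have "\<dots> = (\<Sum>j<degree P. if j = r then w $ j else 0)"
    by (intro sum.cong) (use r in auto)
  also have "\<dots> = w $ r" using r by simp
  finally show "krylov P (krylov_inv P w) $ r = w $ r" .
qed (use assms in auto)

lemma degree_krylov_inv: "degree (krylov_inv P w) < degree P"
proof -
  have "degree (krylov_inv P w) \<le> degree P - 1"
    unfolding krylov_inv_def
    by (intro degree_sum_le order.trans[OF degree_smult_le] degree_le)
      (auto simp: coeff_poly_shift intro!: coeff_eq_0)
  then show ?thesis using degree_pos by simp
qed

text \<open>Only the Horner polynomial for index 0 reaches degree \<open>degree P - 1\<close>, so
  \<open>w $ 0\<close> is the coefficient of \<open>krylov_inv P w\<close> there. After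
  multiplication by \<open>X\<close>, subtracting \<open>w $ 0\<close> times \<open>P\<close>
  removes the overflow: one step of long division.\<close>

lemma krylov_inv_pCons:
  assumes w: "w \<in> carrier_vec (degree P)"
  shows "krylov_inv P (c \<cdot>\<^sub>v unit_vec (degree P) (degree P - 1) + companion P *\<^sub>v w) =
    pCons c (krylov_inv P w) - Polynomial.smult (w $ 0) P"
proof -
  define d where "d = degree P - 1"
  have d: "degree P = Suc d" using degree_pos by (simp add: d_def)
  define q where "q j = poly_shift (Suc j) P" for j
  have qd: "q d = 1" using poly_shift_degree[of P] monic by (simp add: q_def d one_pCons)
  \<comment> \<open>The Horner recursion read backwards: \<open>X\<close> times a Horner polynomial
    is the preceding one without its constant term. Before index 0 comes \<open>P\<close>
    itself.\<close>
  have q: "pCons 0 (q (Suc j)) = q j - [:coeff P (Suc j):]" for j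
    unfolding q_def by (subst (2) poly_shift_unfold) simp
  have q0: "pCons 0 (q 0) = P - [:coeff P 0:]"
    unfolding q_def by (subst poly_shift_unfold[of 0 P, simplified]) simp
  let ?v = "c \<cdot>\<^sub>v unit_vec (degree P) (degree P - 1) + companion P *\<^sub>v w"
  let ?S = "\<Sum>j\<le>d. coeff P j * w $ j"
  have v: "?v $ j = w $ Suc j" if "j < d" for j
    using that w d by (simp add: index_companion_mult_vec del: index_mult_mat_vec)
  have vd: "?v $ d = c - ?S"
    using w d by (simp add: index_companion_mult_vec lessThan_Suc_atMost del: index_mult_mat_vec)
  have "krylov_inv P ?v = (\<Sum>j<d. Polynomial.smult (w $ Suc j) (q j)) + [:c - ?S:]"
    unfolding krylov_inv_def d q_def[symmetric] using v vd[unfolded d] qd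
    by (simp add: d one_pCons)
  \<comment> \<open>The sum from the last row is split into constants, one for each Horner
    polynomial, to match the expansion of \<open>X\<close> times \<open>krylov_inv P w\<close> term
    by term.\<close>
  also have "[:c - ?S:] = [:c:] - (\<Sum>j\<le>d. [:coeff P j * w $ j:])"
    by (simp add: poly_eq_iff coeff_sum coeff_pCons sum_negf split: nat.splits)
  also have "(\<Sum>j\<le>d. [:coeff P j * w $ j:]) =
      [:coeff P 0 * w $ 0:] + (\<Sum>j<d. [:coeff P (Suc j) * w $ Suc j:])"
    by (subst lessThan_Suc_atMost[symmetric], subst sum.lessThan_Suc_shift) simp
  finally have 1: "krylov_inv P ?v = [:c:] - [:coeff P 0 * w $ 0:] +
    (\<Sum>j<d. Polynomial.smult (w $ Suc j) (q j) - [:coeff P (Suc j) * w $ Suc j:])"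
    by (simp add: sum_subtractf)
  have "pCons c (krylov_inv P w) = [:c:] + [:0, 1:] * krylov_inv P w" by simp
  also have "[:0, 1:] * krylov_inv P w =
      (\<Sum>j<Suc d. Polynomial.smult (w $ j) (pCons 0 (q j)))"
    unfolding krylov_inv_def d q_def[symmetric] by (simp only: sum_distrib_left) (simp add: mult.commute)
  also have "\<dots> = Polynomial.smult (w $ 0) (P - [:coeff P 0:]) +
     (\<Sum>j<d. Polynomial.smult (w $ Suc j) (q j - [:coeff P (Suc j):]))"
    unfolding sum.lessThan_Suc_shift q q0 ..
  finally show ?thesis unfolding 1
    by (simp add: smult_diff_right mult.commute)
qed

text \<open>Long division along the coefficients of \<open>f\<close>: each new coefficient costs one
  multiple of \<open>P\<close>, whose factor \<open>krylov P f $ 0\<close> becomes the new constant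
  coefficient of the quotient.\<close>

lemma monic_division:
  obtains g where "f = P * g + krylov_inv P (krylov P f)"
proof -
  have "\<exists>g. f = P * g + krylov_inv P (krylov P f)"
  proof (induction f)
    case 0
    then show ?case by (auto simp: krylov_inv_def intro!: exI[of _ 0])
  next
    case (pCons c f)
    then obtain g where g: "f = P * g + krylov_inv P (krylov P f)" by blast
    have "pCons c f = P * pCons (krylov P f $ 0) g + krylov_inv P (krylov P (pCons c f))"
      unfolding krylov_pCons krylov_inv_pCons[OF krylov_carrier]
      by (subst g) (simp add: pCons_eq_iff)
    then show ?case by blast
  qed
  with that show thesis by blast
qed

text \<open>Together with the surjectivity in \<open>krylov_krylov_inv\<close>, this identifies the
  polynomials modulo \<open>P\<close> with the vectors of length \<open>degree P\<close>.\<close>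

lemma krylov_eq_0_iff: "krylov P f = 0\<^sub>v (degree P) \<longleftrightarrow> P dvd f"
proof
  assume "krylov P f = 0\<^sub>v (degree P)"
  moreover have "krylov_inv P (0\<^sub>v (degree P)) = 0" by (simp add: krylov_inv_def)
  ultimately show "P dvd f" using monic_division[of f] by (metis add.right_neutral dvd_triv_left)
qed (auto simp: krylov_mult_self elim!: dvdE)

text \<open>Every \<open>w\<close> has the form \<open>krylov P h\<close>, and the matrix applied to
  it is \<open>krylov P\<close> of \<open>(monom 1 n - 1) * h\<close>. Pulling the image back
  therefore adds only the kernel, the multiples of \<open>P\<close>.\<close>

lemma krylov_in_image_iff:
  "(\<exists>w\<in>carrier_vec (degree P).
      krylov P f = (companion P ^\<^sub>m n - 1\<^sub>m (degree P)) *\<^sub>v w) \<longleftrightarrow>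
   (\<exists>g h. f = P * g + (monom 1 n - 1) * h)"
proof -
  have *: "krylov P ((monom 1 n - 1) * h) =
      (companion P ^\<^sub>m n - 1\<^sub>m (degree P)) *\<^sub>v krylov P h" for h
    unfolding left_diff_distrib krylov_diff krylov_monom_mult
    by (subst minus_mult_distrib_mat_vec[where nr = "degree P" and nc = "degree P"])
      (auto intro: pow_carrier_mat)
  show ?thesis
  proof (intro iffI; elim bexE exE)
    fix w assume "w \<in> carrier_vec (degree P)"
      "krylov P f = (companion P ^\<^sub>m n - 1\<^sub>m (degree P)) *\<^sub>v w"
    then have "krylov P f = krylov P ((monom 1 n - 1) * krylov_inv P w)"
      by (simp add: * krylov_krylov_inv)
    then have "krylov P (f - (monom 1 n - 1) * krylov_inv P w) = 0\<^sub>v (degree P)"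
      by (simp add: krylov_diff)
    then obtain g where "f - (monom 1 n - 1) * krylov_inv P w = P * g"
      unfolding krylov_eq_0_iff by blast
    then show "\<exists>g h. f = P * g + (monom 1 n - 1) * h" by (metis diff_eq_eq)
  next
    fix g h assume "f = P * g + (monom 1 n - 1) * h"
    then have "krylov P f = (companion P ^\<^sub>m n - 1\<^sub>m (degree P)) *\<^sub>v krylov P h"
      by (simp add: krylov_add krylov_mult_self *)
        (intro eq_vecI, auto)
    then show "\<exists>w\<in>carrier_vec (degree P).
      krylov P f = (companion P ^\<^sub>m n - 1\<^sub>m (degree P)) *\<^sub>v w" by auto
  qed
qed

end


section \<open>Circulant matrices\<close>

lemma monom_1_power: "monom (1::'a::comm_ring_1) n ^ q = monom 1 (n * q)"
  by (simp add: monom_power)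

lemma bij_betw_add_mod:
  assumes "n > 0"
  shows "bij_betw (\<lambda>i. (i + d) mod n) {..<n} {..<n::nat}"
proof -
  have "inj_on (\<lambda>i. (i + d) mod n) {..<n}"
  proof (rule inj_onI)
    fix i j assume "i \<in> {..<n}" "j \<in> {..<n}" "(i + d) mod n = (j + d) mod n"
    then show "i = j"
      by (metis cong_add_rcancel_nat cong_def lessThan_iff mod_less)
  qed
  moreover have "(\<lambda>i. (i + d) mod n) ` {..<n} \<subseteq> {..<n}" using assms by auto
  ultimately show ?thesis
    by (simp add: bij_betw_def endo_inj_surj)
qed

text \<open>Each exponent may be reduced to its residue, because \<open>X ^ n - 1\<close> divides
  \<open>(X ^ n) ^ q - 1\<close> for every \<open>q\<close>.\<close>

lemma dvd_monom_diff_mod: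
  assumes "i mod n = j mod n"
  shows "(monom (1::int) n - 1) dvd (monom c i - monom c j)"
proof -
  have *: "(monom (1::int) n - 1) dvd (monom c i - monom c (i mod n))" for i
  proof -
    have "(monom (1::int) n - 1) dvd monom 1 n ^ (i div n) - 1"
      by (simp add: power_diff_1_eq)
    then have "(monom (1::int) n - 1) dvd monom c (i mod n) * (monom 1 (n * (i div n)) - 1)"
      by (simp add: monom_1_power)
    also have "\<dots> = monom c i - monom c (i mod n)"
      by (simp add: right_diff_distrib mult_monom)
    finally show ?thesis .
  qed
  from dvd_diff[OF *[of i] *[of j]] assms show ?thesis by simp
qed

text \<open>With \<open>T\<close> the cyclic shift, this is \<open>c\<close> minus the sum of
  \<open>T ^ d\<close> over \<open>d\<close> in \<open>D\<close>. Adding \<open>n\<close> first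
  protects \<open>j - i\<close> from truncated subtraction.\<close>

definition circ_mat :: "nat \<Rightarrow> nat set \<Rightarrow> int \<Rightarrow> int mat" where
  "circ_mat n D c = mat n n (\<lambda>(i, j).
     (if i = j then c else 0) - (if (j + n - i) mod n \<in> D then 1 else 0))"

lemma circ_mat_carrier [simp]: "circ_mat n D c \<in> carrier_mat n n"
  and dim_circ_mat [simp]: "dim_row (circ_mat n D c) = n" "dim_col (circ_mat n D c) = n"
  by (simp_all add: circ_mat_def)

lemma index_circ_mat_mult_vec:
  assumes y: "y \<in> carrier_vec n" and D: "D \<subseteq> {..<n}" and i: "i < n"
  shows "(circ_mat n D c *\<^sub>v y) $ i = c * y $ i - (\<Sum>d\<in>D. y $ ((i + d) mod n))"
proof -
  have "(circ_mat n D c *\<^sub>v y) $ i =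
      (\<Sum>j<n. (if j = i then c * y $ j else 0) - (if (j + n - i) mod n \<in> D then y $ j else 0))"
    using y i by (auto simp: circ_mat_def scalar_prod_def atLeast0LessThan algebra_simps
        intro!: sum.cong)
  also have "\<dots> = c * y $ i - (\<Sum>j<n. if (j + n - i) mod n \<in> D then y $ j else 0)"
    using i by (simp add: sum_subtractf)
  also have "(\<Sum>j<n. if (j + n - i) mod n \<in> D then y $ j else 0) =
      (\<Sum>j\<in>{j\<in>{..<n}. (j + n - i) mod n \<in> D}. y $ j)"
    by (rule sum.inter_filter[symmetric]) simp
  also have "\<dots> = (\<Sum>d\<in>D. y $ ((i + d) mod n))"
  proof (rule sum.reindex_bij_witness[where j = "\<lambda>j. (j + n - i) mod n" and i = "\<lambda>d. (i + d) mod n"])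
    fix d assume "d \<in> D"
    then have d: "d < n" using D by auto
    show "((i + d) mod n + n - i) mod n = d"
      using d i by (cases "i + d < n") (auto simp: mod_if)
    then show "(i + d) mod n \<in> {j \<in> {..<n}. (j + n - i) mod n \<in> D}"
      using \<open>d \<in> D\<close> i by auto
  next
    fix j assume "j \<in> {j \<in> {..<n}. (j + n - i) mod n \<in> D}"
    then show "(i + (j + n - i) mod n) mod n = j"
      using i by (auto simp: mod_add_right_eq)
    then show "y $ ((i + (j + n - i) mod n) mod n) = y $ j" by simp
  qed auto
  finally show ?thesis .
qed

text \<open>Strict diagonal dominance: look at an entry of maximal modulus of a kernel vector.\<close>

lemma det_circ_mat_nonzero:
  assumes D: "D \<subseteq> {..<n}" and c: "int (card D) < c"
  shows "det (circ_mat n D c) \<noteq> 0"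
proof
  assume "det (circ_mat n D c) = 0"
  then obtain v where v: "v \<in> carrier_vec n" "v \<noteq> 0\<^sub>v n" "circ_mat n D c *\<^sub>v v = 0\<^sub>v n"
    using det_0_iff_vec_prod_zero[of "circ_mat n D c" n] by auto
  then obtain i0 where i0: "i0 < n" "v $ i0 \<noteq> 0"
    by (metis carrier_vecD eq_vecI index_zero_vec)
  define m where "m = Max ((\<lambda>i. \<bar>v $ i\<bar>) ` {..<n})"
  have le: "\<bar>v $ i\<bar> \<le> m" if "i < n" for i
    unfolding m_def using that by (intro Max_ge) auto
  have "m \<in> (\<lambda>i. \<bar>v $ i\<bar>) ` {..<n}"
    unfolding m_def using i0 by (intro Max_in) auto
  then obtain i where i: "i < n" "\<bar>v $ i\<bar> = m" by auto
  have "c * v $ i = (\<Sum>d\<in>D. v $ ((i + d) mod n))"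
    using index_circ_mat_mult_vec[OF v(1) D i(1), of c] v(3) i(1) by simp
  then have "c * m = \<bar>\<Sum>d\<in>D. v $ ((i + d) mod n)\<bar>"
    using i c by (metis abs_mult abs_of_nonneg le_less_trans less_imp_le of_nat_0_le_iff)
  also have "\<dots> \<le> (\<Sum>d\<in>D. m)"
    using i(1) by (intro order.trans[OF sum_abs] sum_mono le) auto
  finally have "c * m \<le> int (card D) * m" by simp
  moreover have "m > 0" using le[OF i0(1)] i0(2) by linarith
  ultimately show False using c by simp
qed

section \<open>Vectors as polynomials modulo \<open>X ^ n - 1\<close>\<close>

definition vec_poly :: "nat \<Rightarrow> int vec \<Rightarrow> int poly" where
  "vec_poly n x = (\<Sum>i<n. monom (x $ i) i)"

lemma coeff_vec_poly: "coeff (vec_poly n x) i = (if i < n then x $ i else 0)"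
  by (simp add: vec_poly_def coeff_sum)

lemma vec_poly_add:
  assumes "x \<in> carrier_vec m" "y \<in> carrier_vec m" "n \<le> m"
  shows "vec_poly n (x + y) = vec_poly n x + vec_poly n y"
  using assms by (auto simp: poly_eq_iff coeff_vec_poly)

text \<open>Moving the entry at \<open>i + d\<close> to place \<open>i\<close> divides by
  \<open>X ^ d\<close>, and modulo \<open>X ^ n - 1\<close> the inverse of \<open>X ^ d\<close> is
  \<open>X ^ (n - d)\<close>.\<close>

lemma vec_poly_shift_cong:
  assumes "d < n"
  shows "(monom 1 n - 1) dvd
    (\<Sum>i<n. monom (y $ ((i + d) mod n)) i) - monom 1 (n - d) * vec_poly n y"
proof -
  have "monom 1 (n - d) * vec_poly n y = (\<Sum>j<n. monom (y $ j) (n - d + j))"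
    by (simp add: vec_poly_def sum_distrib_left mult_monom)
  also have "\<dots> = (\<Sum>i<n. monom (y $ ((i + d) mod n)) (n - d + (i + d) mod n))"
    using assms by (intro sum.reindex_bij_betw[OF bij_betw_add_mod, symmetric]) auto
  finally have "(\<Sum>i<n. monom (y $ ((i + d) mod n)) i) - monom 1 (n - d) * vec_poly n y =
    (\<Sum>i<n. monom (y $ ((i + d) mod n)) i - monom (y $ ((i + d) mod n)) (n - d + (i + d) mod n))"
    by (simp add: sum_subtractf)
  also have "(monom 1 n - 1) dvd \<dots>"
  proof (intro dvd_sum dvd_monom_diff_mod)
    fix i
    have "(n - d + (i + d) mod n) mod n = (n - d + (i + d)) mod n" by (rule mod_add_right_eq)
    also have "n - d + (i + d) = i + n" using assms by simp
    finally show "i mod n = (n - d + (i + d) mod n) mod n" by simp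
  qed
  finally show ?thesis .
qed

text \<open>The multiplier by which \<open>circ_mat\<close> acts modulo \<open>X ^ n - 1\<close>.
  The exponent is \<open>n - d\<close> because row \<open>i\<close> picks the entry at
  \<open>i + d\<close>, a shift by \<open>- d\<close>.\<close>

definition circ_poly :: "nat \<Rightarrow> nat set \<Rightarrow> int \<Rightarrow> int poly" where
  "circ_poly n D c = [:c:] - (\<Sum>d\<in>D. monom 1 (n - d))"

lemma vec_poly_circ_mat_cong:
  assumes y: "y \<in> carrier_vec n" and D: "D \<subseteq> {..<n}"
  shows "(monom 1 n - 1) dvd vec_poly n (circ_mat n D c *\<^sub>v y) - circ_poly n D c * vec_poly n y"
proof -
  have "vec_poly n (circ_mat n D c *\<^sub>v y) =
      (\<Sum>i<n. [:c:] * monom (y $ i) i - (\<Sum>d\<in>D. monom (y $ ((i + d) mod n)) i))"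
    unfolding vec_poly_def using assms
    by (intro sum.cong)
      (auto simp: index_circ_mat_mult_vec smult_monom diff_monom[symmetric] monom_sum simp del: index_mult_mat_vec)
  also have "\<dots> = [:c:] * vec_poly n y - (\<Sum>d\<in>D. \<Sum>i<n. monom (y $ ((i + d) mod n)) i)"
    unfolding sum_subtractf vec_poly_def sum_distrib_left sum.swap[of _ D "{..<n}"] ..
  finally have "vec_poly n (circ_mat n D c *\<^sub>v y) - circ_poly n D c * vec_poly n y =
     - (\<Sum>d\<in>D. (\<Sum>i<n. monom (y $ ((i + d) mod n)) i) - monom 1 (n - d) * vec_poly n y)"
    unfolding circ_poly_def left_diff_distrib sum_distrib_right by (simp add: sum_subtractf)
  also have "(monom 1 n - 1) dvd \<dots>"
    unfolding dvd_minus_iff using D by (intro dvd_sum vec_poly_shift_cong) auto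
  finally show ?thesis .
qed

lemma ex_vec_poly_cong:
  assumes "n > 0"
  obtains y where "y \<in> carrier_vec n" "(monom 1 n - 1) dvd g - vec_poly n y"
proof
  \<comment> \<open>Folding: coefficients of \<open>g\<close> whose exponents agree modulo
    \<open>n\<close> are added up.\<close>
  define y where "y = vec n (\<lambda>i. \<Sum>j\<in>{j\<in>{..degree g}. j mod n = i}. coeff g j)"
  show "y \<in> carrier_vec n" by (simp add: y_def)
  have "vec_poly n y = (\<Sum>i<n. \<Sum>j\<in>{j\<in>{..degree g}. j mod n = i}. monom (coeff g j) (j mod n))"
    unfolding vec_poly_def by (intro sum.cong) (auto simp: y_def monom_sum intro!: sum.cong)
  also have "\<dots> = (\<Sum>j\<le>degree g. monom (coeff g j) (j mod n))"
    using assms by (intro sum.group) auto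
  finally have "g - vec_poly n y =
      (\<Sum>j\<le>degree g. monom (coeff g j) j - monom (coeff g j) (j mod n))"
    by (simp add: sum_subtractf poly_as_sum_of_monoms)
  also have "(monom 1 n - 1) dvd \<dots>"
    by (intro dvd_sum dvd_monom_diff_mod) simp
  finally show "(monom 1 n - 1) dvd g - vec_poly n y" .
qed

lemma degree_monom_minus_1:
  assumes "n > 0"
  shows "degree (monom (1::int) n - 1) = n"
  by (rule antisym[OF degree_le le_degree]) (use assms in auto)

text \<open>Both polynomials have degree below \<open>n\<close>, so a nonzero difference cannot be a
  multiple of a polynomial of degree \<open>n\<close>.\<close>

lemma vec_poly_cong_imp_eq:
  assumes "n > 0" "x \<in> carrier_vec n" "y \<in> carrier_vec n"
    and dvd: "(monom 1 n - 1) dvd vec_poly n x - vec_poly n y"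
  shows "x = y"
proof -
  let ?f = "vec_poly n x - vec_poly n y"
  have "?f = 0"
  proof (rule ccontr)
    assume "?f \<noteq> 0"
    then have "n \<le> degree ?f"
      using dvd_imp_degree_le[OF dvd] assms(1) by (simp add: degree_monom_minus_1)
    then have "coeff ?f (degree ?f) = 0"
      by (simp only: coeff_diff coeff_vec_poly) simp
    with \<open>?f \<noteq> 0\<close> show False by (simp only: leading_coeff_0_iff)
  qed
  then have "coeff (vec_poly n x) i = coeff (vec_poly n y) i" for i by simp
  then have "x $ i = y $ i" if "i < n" for i
    using that by (metis coeff_vec_poly)
  with assms(2,3) show ?thesis by (intro eq_vecI) auto
qed

text \<open>Each class modulo \<open>X ^ n - 1\<close> has exactly one representative
  \<open>vec_poly n y\<close>, and on classes the matrix multiplies by \<open>circ_poly\<close>. So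
  its image is the ideal generated by \<open>circ_poly\<close>, taken modulo
  \<open>X ^ n - 1\<close>.\<close>

lemma circ_mat_image_iff:
  assumes n: "n > 0" and x: "x \<in> carrier_vec n" and D: "D \<subseteq> {..<n}"
  shows "(\<exists>y\<in>carrier_vec n. x = circ_mat n D c *\<^sub>v y) \<longleftrightarrow>
    (\<exists>g h. vec_poly n x = circ_poly n D c * g + (monom 1 n - 1) * h)"
proof (intro iffI; elim bexE exE)
  fix y assume "y \<in> carrier_vec n" "x = circ_mat n D c *\<^sub>v y"
  with vec_poly_circ_mat_cong[OF _ D, of y c] obtain h
    where "vec_poly n x - circ_poly n D c * vec_poly n y = (monom 1 n - 1) * h" by (auto elim: dvdE)
  then have "vec_poly n x = circ_poly n D c * vec_poly n y + (monom 1 n - 1) * h"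
    by (simp add: diff_eq_eq add.commute)
  then show "\<exists>g h. vec_poly n x = circ_poly n D c * g + (monom 1 n - 1) * h" by blast
next
  fix g h assume gh: "vec_poly n x = circ_poly n D c * g + (monom 1 n - 1) * h"
  obtain y where y: "y \<in> carrier_vec n" "(monom 1 n - 1) dvd g - vec_poly n y"
    using ex_vec_poly_cong[OF n] .
  have "vec_poly n x - vec_poly n (circ_mat n D c *\<^sub>v y) =
     (monom 1 n - 1) * h + circ_poly n D c * (g - vec_poly n y)
     - (vec_poly n (circ_mat n D c *\<^sub>v y) - circ_poly n D c * vec_poly n y)"
    by (simp add: gh algebra_simps)
  also have "(monom 1 n - 1) dvd \<dots>"
    by (rule dvd_diff[OF dvd_add[OF dvd_triv_left dvd_mult[OF y(2)]] vec_poly_circ_mat_cong[OF y(1) D]])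
  finally have "x = circ_mat n D c *\<^sub>v y"
    using vec_poly_cong_imp_eq[OF n x mult_mat_vec_carrier[OF circ_mat_carrier y(1)]] by blast
  with y(1) show "\<exists>y\<in>carrier_vec n. x = circ_mat n D c *\<^sub>v y" by blast
qed

text \<open>\<open>X\<close> is a unit modulo \<open>X ^ n - 1\<close>, so multiplying one generator of an ideal
  containing \<open>X ^ n - 1\<close> by \<open>- X ^ a\<close> does not change the ideal.\<close>

lemma ideal_cong:
  assumes n: "n > 0" and E: "(monom 1 n - 1) dvd monom 1 a * Q + P"
  shows "(\<exists>g h. f = P * g + (monom (1::int) n - 1) * h) \<longleftrightarrow>
    (\<exists>g h. f = Q * g + (monom 1 n - 1) * h)"
proof -
  let ?E = "monom (1::int) n - 1"
  from E obtain e where e: "monom 1 a * Q + P = ?E * e" by (elim dvdE)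
  have "?E dvd monom 1 (n * a) - monom 1 0" by (rule dvd_monom_diff_mod) simp
  then obtain r where r: "monom 1 (n * a) - 1 = ?E * r" by (auto elim: dvdE)
  \<comment> \<open>The exponent \<open>n * a - a\<close> is a natural number that gives the inverse
    of \<open>X ^ a\<close> modulo \<open>X ^ n - 1\<close>, since the two exponents add up to
    \<open>n * a\<close>.\<close>
  have "monom 1 (n * a - a) * (monom 1 a * Q) = monom 1 (n * a) * Q"
    using n by (simp add: mult.assoc[symmetric] mult_monom)
  also have "\<dots> = Q + ?E * r * Q" by (simp only: r[symmetric]) (simp add: algebra_simps)
  finally have Q: "Q = monom 1 (n * a - a) * (?E * e - P) - ?E * r * Q"
    by (simp add: e[symmetric])
  show ?thesis
  proof (intro iffI; elim exE)
    fix g h assume "f = P * g + ?E * h"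
    moreover have "?E * (h + e * g) = ?E * h + (monom 1 a * Q + P) * g"
      by (simp only: e distrib_left mult.assoc)
    ultimately have "f = Q * (- monom 1 a * g) + ?E * (h + e * g)"
      by (simp add: algebra_simps)
    then show "\<exists>g h. f = Q * g + ?E * h" by blast
  next
    fix g h assume f: "f = Q * g + ?E * h"
    have "f = P * (- monom 1 (n * a - a) * g) + ?E * (h + monom 1 (n * a - a) * e * g - r * Q * g)"
      unfolding f by (subst Q) (simp add: algebra_simps)
    then show "\<exists>g h. f = P * g + ?E * h" by blast
  qed
qed


section \<open>Torsion in cokernels and Laplacians\<close>

text \<open>By \<open>tors\<close>, \<open>K\<close> is the preimage in \<open>V\<close> of the
  torsion subgroup of \<open>V Mod N\<close>. The first isomorphism theorem for \<open>h\<close>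
  restricted to \<open>K\<close>, whose kernel is \<open>N\<close>, then gives the claim.\<close>

lemma torsion_Mod_iso:
  assumes "comm_group V" "subgroup N V" "subgroup K V" "N \<subseteq> K"
    and "group H" "h \<in> hom V H" and surj: "h ` K = carrier H"
    and ker: "\<And>x. x \<in> K \<Longrightarrow> h x = \<one>\<^bsub>H\<^esub> \<longleftrightarrow> x \<in> N"
    and tors: "\<And>x. x \<in> carrier V \<Longrightarrow> (\<exists>m::nat. m > 0 \<and> x [^]\<^bsub>V\<^esub> m \<in> N) \<longleftrightarrow> x \<in> K"
  shows "torsion_group (V Mod N) \<cong> H"
proof -
  interpret V: comm_group V by fact
  interpret N: subgroup N V by fact
  interpret K: subgroup K V by fact
  interpret H: group H by fact
  interpret N: normal N V using V.normal_iff_subgroup \<open>subgroup N V\<close> by simp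
  define W where "W = V\<lparr>carrier := K\<rparr>"
  interpret W: group W unfolding W_def by (rule K.subgroup_is_group) (rule V.is_group)
  interpret h: group_hom W H h
  proof (unfold_locales, rule homI)
    show "h x \<in> carrier H" if "x \<in> carrier W" for x
      using that surj by (auto simp: W_def)
    show "h (x \<otimes>\<^bsub>W\<^esub> y) = h x \<otimes>\<^bsub>H\<^esub> h y" if "x \<in> carrier W" "y \<in> carrier W" for x y
      using that hom_mult[OF \<open>h \<in> hom V H\<close>] by (auto simp: W_def)
  qed
  have "kernel W H h = N"
    using ker \<open>N \<subseteq> K\<close> by (auto simp: kernel_def W_def)
  moreover have "h ` carrier W = carrier H" using surj by (simp add: W_def)
  ultimately have iso: "(\<lambda>C. the_elem (h ` C)) \<in> iso (W Mod N) H"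
    using h.FactGroup_iso_set by metis
  \<comment> \<open>Cosets and their products are the same sets in \<open>W\<close> and in
    \<open>V\<close>, so the isomorphism carries over once the carriers agree.\<close>
  have coset: "r_coset W N x = r_coset V N x" for x
    by (simp add: W_def r_coset_def)
  have mult: "monoid.mult (W Mod N) = monoid.mult (torsion_group (V Mod N))"
    unfolding torsion_group_def FactGroup_def set_mult_def W_def by simp
  have "(\<exists>m::nat. m > 0 \<and> (N #>\<^bsub>V\<^esub> x) [^]\<^bsub>V Mod N\<^esub> m = N) \<longleftrightarrow> x \<in> K" if "x \<in> carrier V" for x
  proof -
    have "(N #>\<^bsub>V\<^esub> x) [^]\<^bsub>V Mod N\<^esub> m = N \<longleftrightarrow> x [^]\<^bsub>V\<^esub> m \<in> N" for m :: nat
    proof -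
      have "N #>\<^bsub>V\<^esub> (x [^]\<^bsub>V\<^esub> m) = N \<longleftrightarrow> x [^]\<^bsub>V\<^esub> m \<in> N"
        using V.coset_join1[OF _ V.nat_pow_closed[OF that] \<open>subgroup N V\<close>]
          V.coset_join2[OF V.nat_pow_closed[OF that] \<open>subgroup N V\<close>] by (rule iffI)
      then show ?thesis by (simp only: N.FactGroup_pow[OF that])
    qed
    with tors[OF that] show ?thesis by simp
  qed
  then have "{C \<in> r_coset V N ` carrier V. \<exists>m::nat. m > 0 \<and> C [^]\<^bsub>V Mod N\<^esub> m = N} = r_coset V N ` K"
    using K.subset by blast
  then have carrier: "carrier (torsion_group (V Mod N)) = carrier (W Mod N)"
    unfolding torsion_group_def carrier_FactGroup coset by (simp add: carrier_FactGroup W_def)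
  have "(\<lambda>C. the_elem (h ` C)) \<in> iso (torsion_group (V Mod N)) H"
    using iso by (simp only: iso_def hom_def carrier mult)
  then show ?thesis by (rule is_isoI)
qed

section \<open>Integer vectors: multiples, matrix images and Laplacians\<close>

lemma pow_monoid_vec:
  assumes "x \<in> carrier_vec n"
  shows "x [^]\<^bsub>monoid_vec TYPE(int) n\<^esub> (m::nat) = int m \<cdot>\<^sub>v x"
proof (induction m)
  case 0
  then show ?case using assms by (auto simp: monoid_vec_simps)
next
  case (Suc m)
  have "int m \<cdot>\<^sub>v x + x = int (Suc m) \<cdot>\<^sub>v x"
    by (intro eq_vecI) (auto simp: distrib_right)
  with Suc.IH show ?case by (simp add: monoid_vec_simps)
qed

lemma subgroup_mat_image: "subgroup (mat_image M) (monoid_vec TYPE(int) (dim_row M))"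
proof -
  interpret C: comm_group "monoid_vec TYPE(int) (dim_col M)" by (rule comm_group_vec)
  interpret R: comm_group "monoid_vec TYPE(int) (dim_row M)" by (rule comm_group_vec)
  have M: "M \<in> carrier_mat (dim_row M) (dim_col M)" by simp
  interpret group_hom "monoid_vec TYPE(int) (dim_col M)" "monoid_vec TYPE(int) (dim_row M)" "\<lambda>v. M *\<^sub>v v"
    by unfold_locales
      (auto simp: hom_def monoid_vec_simps mult_add_distrib_mat_vec[OF M]
        intro: mult_mat_vec_carrier[OF M])
  show ?thesis
    using img_is_subgroup by (simp add: mat_image_def monoid_vec_simps)
qed

text \<open>The degree counts the neighbours, so the diagonal term supplies one copy of
  \<open>y $ i\<close> for each of them.\<close>

lemma index_laplacian_mult_vec:
  assumes "pair_graph G" and V: "pverts G = {0..<m}" and y: "y \<in> carrier_vec m" and i: "i < m"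
  shows "(laplacian G *\<^sub>v y) $ i = (\<Sum>j\<in>{j. (i, j) \<in> parcs G}. y $ i - y $ j)"
proof -
  interpret pair_graph G by fact
  have sub: "{j. (i, j) \<in> parcs G} \<subseteq> {..<m}"
    using wellformed' V by fastforce
  have "out_arcs (with_proj G) i = Pair i ` {j. (i, j) \<in> parcs G}"
    by (auto simp: out_arcs_def)
  then have deg: "out_degree (with_proj G) i = card {j. (i, j) \<in> parcs G}"
    by (simp add: out_degree_def card_image inj_on_def)
  have entry: "laplacian G $$ (i, j) =
      (if j = i then int (card {j. (i, j) \<in> parcs G}) else 0) -
      (if j \<in> {j. (i, j) \<in> parcs G} then 1 else 0)" if "j < m" for j
    using i that V deg by (simp add: laplacian_def degree_matrix_def adjacency_matrix_def)
  have L: "laplacian G \<in> carrier_mat m m"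
    using V by (intro carrier_matI) (simp_all add: laplacian_def degree_matrix_def adjacency_matrix_def Let_def)
  have "(laplacian G *\<^sub>v y) $ i = (\<Sum>j<m. laplacian G $$ (i, j) * y $ j)"
    using y i L by (simp add: scalar_prod_def atLeast0LessThan)
  also have "\<dots> =
    (\<Sum>j<m. (if j = i then int (card {j. (i, j) \<in> parcs G}) * y $ j else 0) -
      (if j \<in> {j. (i, j) \<in> parcs G} then y $ j else 0))"
    by (intro sum.cong) (auto simp: entry left_diff_distrib)
  also have "\<dots> = int (card {j. (i, j) \<in> parcs G}) * y $ i - (\<Sum>j\<in>{j. (i, j) \<in> parcs G}. y $ j)"
    using i sub by (simp add: sum_subtractf sum.If_cases Int_absorb1)
  finally show ?thesis by (simp add: sum_subtractf)
qed

text \<open>The total is a sum of differences over all arcs. Reversing the arcs, a bijection by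
  symmetry, changes its sign.\<close>

lemma sum_laplacian_mult_vec:
  assumes "pair_graph G" and V: "pverts G = {0..<m}" and y: "y \<in> carrier_vec m"
  shows "(\<Sum>i<m. (laplacian G *\<^sub>v y) $ i) = 0"
proof -
  interpret pair_graph G by fact
  let ?S = "Sigma {..<m} (\<lambda>i. {j. (i, j) \<in> parcs G})"
  have S: "?S = parcs G" using wellformed' V by fastforce
  have fin: "finite {j. (i, j) \<in> parcs G}" for i
    using finite_subset[of "{j. (i, j) \<in> parcs G}" "snd ` parcs G"] pair_finite_arcs by force
  have "(\<Sum>i<m. (laplacian G *\<^sub>v y) $ i) = (\<Sum>(i, j)\<in>parcs G. y $ i - y $ j)"
    using V y fin
    by (simp add: index_laplacian_mult_vec[OF assms(1)] sum.Sigma S del: index_mult_mat_vec)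
  moreover have "(\<Sum>e\<in>parcs G. y $ fst e - y $ snd e) = (\<Sum>e\<in>parcs G. y $ snd e - y $ fst e)"
    using pair_sym_arcs
    by (intro sum.reindex_bij_witness[where i = prod.swap and j = prod.swap])
       (auto simp: symmetric_def sym_def)
  ultimately show ?thesis by (simp add: split_def sum_subtractf)
qed


section \<open>The cone over a circulant graph\<close>

text \<open>A step back by \<open>s l\<close> is encoded as a step forward by
  \<open>n - s l\<close>, so that neighbours are \<open>(i + d) mod n\<close> with natural numbers
  \<open>d\<close>.\<close>

definition jump_set :: "nat \<Rightarrow> nat \<Rightarrow> (nat \<Rightarrow> nat) \<Rightarrow> nat set" where
  "jump_set n k s = s ` {1..k} \<union> (\<lambda>l. n - s l) ` {1..k}"

text \<open>Minus the Laurent polynomial of the graph, shifted by \<open>z ^ s k\<close>; the sign makes it monic.\<close>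

definition jump_poly :: "nat \<Rightarrow> (nat \<Rightarrow> nat) \<Rightarrow> int poly" where
  "jump_poly k s = (\<Sum>l = 1..k. monom 1 (s k + s l) + monom 1 (s k - s l)) - monom (int (2 * k + 1)) (s k)"

context
  fixes n k :: nat and s :: "nat \<Rightarrow> nat"
  assumes k: "k \<ge> 1" and s1: "1 \<le> s 1" and mono: "strict_mono_on {1..k} s"
    and less: "2 * s k < n"
begin

section \<open>The residues of the jumps\<close>

lemma jump_bounds:
  assumes "l \<in> {1..k}"
  shows "1 \<le> s l" "s l \<le> s k"
proof -
  have "mono_on {1..k} s" using mono by (rule strict_mono_on_imp_mono_on)
  then have "s 1 \<le> s l" "s l \<le> s k" using assms k mono_onD[of "{1..k}" s 1 l] mono_onD[of "{1..k}" s l k] by auto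
  with s1 show "1 \<le> s l" "s l \<le> s k" by auto
qed

lemma jump_less: "l \<in> {1..k} \<Longrightarrow> 2 * s l < n"
  using jump_bounds[of l] less by linarith

lemma jump_eq_iff: "l \<in> {1..k} \<Longrightarrow> l' \<in> {1..k} \<Longrightarrow> s l = s l' \<longleftrightarrow> l = l'"
  using strict_mono_on_imp_inj_on[OF mono] by (auto dest: inj_onD)

lemma n_pos: "n > 0" using less by simp

lemma jump_set_subset: "jump_set n k s \<subseteq> {..<n}"
  using jump_bounds jump_less n_pos by (fastforce simp: jump_set_def)

text \<open>As \<open>2 * s l < n\<close>, forward jumps lie below half of \<open>n\<close> and
  backward ones above it, so no residue occurs twice.\<close>

lemma sum_jump_set: "(\<Sum>d\<in>jump_set n k s. f d) = (\<Sum>l = 1..k. f (s l) + f (n - s l))"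
  for f :: "nat \<Rightarrow> 'b::comm_monoid_add"
proof -
  have inj1: "inj_on s {1..k}" by (auto simp: inj_on_def jump_eq_iff)
  have inj2: "inj_on (\<lambda>l. n - s l) {1..k}"
  proof (rule inj_onI)
    fix x y assume *: "x \<in> {1..k}" "y \<in> {1..k}" "n - s x = n - s y"
    then have "s x = s y" using jump_less[OF *(1)] jump_less[OF *(2)] by linarith
    then show "x = y" using * jump_eq_iff by blast
  qed
  have "s l \<noteq> n - s l'" if "l \<in> {1..k}" "l' \<in> {1..k}" for l l'
    using jump_less[OF that(1)] jump_less[OF that(2)] by linarith
  then have "s ` {1..k} \<inter> (\<lambda>l. n - s l) ` {1..k} = {}" by blast
  then have "(\<Sum>d\<in>jump_set n k s. f d) = sum f (s ` {1..k}) + sum f ((\<lambda>l. n - s l) ` {1..k})"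
    unfolding jump_set_def by (intro sum.union_disjoint) auto
  then show ?thesis
    by (simp only: sum.reindex[OF inj1] sum.reindex[OF inj2] sum.distrib comp_def)
qed

lemma card_jump_set: "card (jump_set n k s) = 2 * k"
proof -
  have "card (jump_set n k s) = (\<Sum>d\<in>jump_set n k s. 1)" by simp
  also have "\<dots> = 2 * k" unfolding sum_jump_set by simp
  finally show ?thesis .
qed

lemma circulant_neighbours:
  assumes i: "i < n"
  shows "{j. (i, j) \<in> parcs (circulant_graph n k s)} = (\<lambda>d. (i + d) mod n) ` jump_set n k s"
proof -
  have plus: "[int j = int i + int (s l)] (mod int n) \<longleftrightarrow> j = (i + s l) mod n" if "j < n" for j l
    using that by (simp only: cong_int_iff flip: of_nat_add) (simp add: cong_def)
  have minus: "[int j = int i - int (s l)] (mod int n) \<longleftrightarrow> j = (i + (n - s l)) mod n"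
    if "j < n" "l \<in> {1..k}" for j l
  proof -
    have "int i - int (s l) = int (i + (n - s l)) - int n"
      using jump_less[OF that(2)] by simp
    then have "[int j = int i - int (s l)] (mod int n) \<longleftrightarrow> [int j = int (i + (n - s l))] (mod int n)"
      by (simp only: cong_def minus_mod_self2)
    also have "\<dots> \<longleftrightarrow> j = (i + (n - s l)) mod n"
      using that(1) by (simp only: cong_int_iff) (simp add: cong_def)
    finally show ?thesis .
  qed
  show ?thesis
    using i n_pos by (auto simp: circulant_graph_def jump_set_def plus minus) (auto simp: plus minus)
qed

section \<open>The Laplacian of the cone: image and torsion\<close>

lemma pverts_cone: "pverts (cone_graph (circulant_graph n k s)) = {0..<Suc n}"
  by (auto simp: cone_graph_def circulant_graph_def)

lemma pair_graph_cone: "pair_graph (cone_graph (circulant_graph n k s))"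
proof (rule pair_graph_cone_graph)
  show "pair_graph (circulant_graph n k s)"
    by (rule pair_graph_circulant) (use jump_bounds jump_less in fastforce)
qed (simp add: circulant_graph_def)

text \<open>Vertex \<open>i\<close> has \<open>2 * k\<close> neighbours in the circulant graph and
  one more, the apex \<open>n\<close>; hence the diagonal value \<open>2 * k + 1\<close> and the
  extra term \<open>- y $ n\<close>.\<close>

lemma index_cone_laplacian_mult_vec:
  assumes y: "y \<in> carrier_vec (Suc n)" and i: "i < n"
  shows "(laplacian (cone_graph (circulant_graph n k s)) *\<^sub>v y) $ i =
    (circ_mat n (jump_set n k s) (int (2 * k + 1)) *\<^sub>v vec n (\<lambda>i. y $ i)) $ i - y $ n"
proof -
  let ?C = "circulant_graph n k s"
  have N: "{j. (i, j) \<in> parcs (cone_graph ?C)} = insert n {j. (i, j) \<in> parcs ?C}"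
    using i by (auto simp: cone_graph_def circulant_graph_def)
  have inj: "inj_on (\<lambda>d. (i + d) mod n) (jump_set n k s)"
    using bij_betw_add_mod[OF n_pos, of i] jump_set_subset
    by (auto simp: bij_betw_def add.commute intro: inj_on_subset)
  have "n \<notin> (\<lambda>d. (i + d) mod n) ` jump_set n k s"
    using n_pos by (metis (no_types, lifting) imageE mod_less_divisor nat_less_le)
  moreover have "finite (jump_set n k s)" by (simp add: jump_set_def)
  ultimately have "(laplacian (cone_graph ?C) *\<^sub>v y) $ i =
     y $ i - y $ n + (\<Sum>d\<in>jump_set n k s. y $ i - y $ ((i + d) mod n))"
    using i by (simp add: index_laplacian_mult_vec[OF pair_graph_cone pverts_cone y] N
      circulant_neighbours sum.reindex[OF inj] del: index_mult_mat_vec)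
  also have "\<dots> = int (2 * k + 1) * y $ i - (\<Sum>d\<in>jump_set n k s. y $ ((i + d) mod n)) - y $ n"
    by (simp add: sum_subtractf card_jump_set algebra_simps)
  also have "\<dots> = (circ_mat n (jump_set n k s) (int (2 * k + 1)) *\<^sub>v vec n (\<lambda>i. y $ i)) $ i - y $ n"
    using i n_pos by (subst index_circ_mat_mult_vec[OF _ jump_set_subset i]) auto
  finally show ?thesis .
qed

lemma cone_laplacian_carrier:
  "laplacian (cone_graph (circulant_graph n k s)) \<in> carrier_mat (Suc n) (Suc n)"
  using pverts_cone by (intro carrier_matI) (simp_all add: laplacian_def degree_matrix_def adjacency_matrix_def Let_def)

lemma cone_laplacian_image_iff:
  assumes x: "x \<in> carrier_vec (Suc n)"
  shows "x \<in> mat_image (laplacian (cone_graph (circulant_graph n k s))) \<longleftrightarrow>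
    (\<Sum>i<Suc n. x $ i) = 0 \<and>
    (\<exists>y\<in>carrier_vec n. vec n (\<lambda>i. x $ i) = circ_mat n (jump_set n k s) (int (2 * k + 1)) *\<^sub>v y)"
    (is "_ \<longleftrightarrow> _ \<and> (\<exists>y\<in>_. _ = ?M *\<^sub>v y)")
proof -
  let ?L = "laplacian (cone_graph (circulant_graph n k s))"
  note sum0 = sum_laplacian_mult_vec[OF pair_graph_cone pverts_cone]
  note L = carrier_matD[OF cone_laplacian_carrier]
  show ?thesis
  proof (intro iffI; (elim conjE bexE)?)
    assume "x \<in> mat_image ?L"
    then obtain y where y: "y \<in> carrier_vec (Suc n)" "x = ?L *\<^sub>v y"
      using L by (auto simp: mat_image_def)
    \<comment> \<open>The rows of \<open>?M\<close> sum to \<open>2 * k + 1 - 2 * k = 1\<close>, so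
      \<open>?M\<close> fixes constant vectors and the term \<open>- y $ n\<close> can be absorbed
      into its argument.\<close>
    define z where "z = vec n (\<lambda>i. y $ i - y $ n)"
    have "x $ i = (?M *\<^sub>v z) $ i" if "i < n" for i
      using that n_pos y(1)
      by (simp add: y(2) index_cone_laplacian_mult_vec[OF y(1)] z_def sum_subtractf card_jump_set
        index_circ_mat_mult_vec[OF _ jump_set_subset] algebra_simps del: index_mult_mat_vec)
    then have "vec n (\<lambda>i. x $ i) = ?M *\<^sub>v z"
      by (intro eq_vecI) (simp_all del: index_mult_mat_vec)
    moreover have "z \<in> carrier_vec n" by (simp add: z_def)
    ultimately show "(\<Sum>i<Suc n. x $ i) = 0 \<and> (\<exists>y\<in>carrier_vec n. vec n (\<lambda>i. x $ i) = ?M *\<^sub>v y)"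
      using sum0[OF y(1)] y(2) by blast
  next
    fix y assume sum: "(\<Sum>i<Suc n. x $ i) = 0" and y: "y \<in> carrier_vec n" "vec n (\<lambda>i. x $ i) = ?M *\<^sub>v y"
    \<comment> \<open>With apex entry 0 the first \<open>n\<close> entries come out right; the last
      one is then forced, as both vectors have coordinate sum 0.\<close>
    define z where "z = vec (Suc n) (\<lambda>i. if i < n then y $ i else 0)"
    have z: "z \<in> carrier_vec (Suc n)" by (simp add: z_def)
    have "vec n (\<lambda>i. z $ i) = y" using y(1) by (intro eq_vecI) (auto simp: z_def)
    then have zx: "(?L *\<^sub>v z) $ i = x $ i" if "i < n" for i
      using that y(2)[symmetric] by (simp add: index_cone_laplacian_mult_vec[OF z] del: index_mult_mat_vec)
        (simp add: z_def)
    have "(?L *\<^sub>v z) $ n = x $ n"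
      using sum sum0[OF z] zx by (simp del: index_mult_mat_vec)
    with zx have "(?L *\<^sub>v z) $ i = x $ i" if "i < Suc n" for i
      using that less_antisym by blast
    then have "x = ?L *\<^sub>v z" using x L by (intro eq_vecI) (auto simp del: index_mult_mat_vec)
    then show "x \<in> mat_image ?L" using z L by (auto simp: mat_image_def)
  qed
qed

text \<open>A positive multiple of the coordinate sum vanishes only if the sum does. Conversely, the
  adjugate shows that the nonzero determinant of the circulant matrix multiplies every vector into
  its image.\<close>

lemma cone_torsion_iff:
  assumes x: "x \<in> carrier_vec (Suc n)"
  shows "(\<exists>m::nat. m > 0 \<and> int m \<cdot>\<^sub>v x \<in> mat_image (laplacian (cone_graph (circulant_graph n k s))))
    \<longleftrightarrow> (\<Sum>i<Suc n. x $ i) = 0"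
proof -
  let ?M = "circ_mat n (jump_set n k s) (int (2 * k + 1))"
  have sum: "(\<Sum>i<Suc n. (int m \<cdot>\<^sub>v x) $ i) = int m * (\<Sum>i<Suc n. x $ i)" for m
    using x unfolding sum_distrib_left by (intro sum.cong) auto
  show ?thesis
  proof (intro iffI; (elim exE conjE)?)
    fix m :: nat
    assume "m > 0" "int m \<cdot>\<^sub>v x \<in> mat_image (laplacian (cone_graph (circulant_graph n k s)))"
    then show "(\<Sum>i<Suc n. x $ i) = 0"
      using x sum[of m] by (simp add: cone_laplacian_image_iff del: sum.lessThan_Suc)
  next
    assume x0: "(\<Sum>i<Suc n. x $ i) = 0"
    define m where "m = nat \<bar>det ?M\<bar>"
    have "det ?M \<noteq> 0"
      by (rule det_circ_mat_nonzero[OF jump_set_subset]) (simp add: card_jump_set)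
    then have m: "m > 0" by (simp add: m_def)
    define v where "v = vec n (\<lambda>i. x $ i)"
    \<comment> \<open>The factor \<open>sgn (det ?M)\<close> turns the determinant produced by the
      adjugate into the positive number \<open>m\<close>.\<close>
    define w where "w = adj_mat ?M *\<^sub>v (sgn (det ?M) \<cdot>\<^sub>v v)"
    note adj = adj_mat[OF circ_mat_carrier[of n "jump_set n k s" "int (2 * k + 1)"]]
    have w: "w \<in> carrier_vec n"
      unfolding w_def by (rule mult_mat_vec_carrier[OF adj(1)]) (simp add: v_def)
    have "?M *\<^sub>v w = (det ?M \<cdot>\<^sub>m 1\<^sub>m n) *\<^sub>v (sgn (det ?M) \<cdot>\<^sub>v v)"
      unfolding w_def adj(2)[symmetric]
      by (rule assoc_mult_mat_vec[OF circ_mat_carrier adj(1), symmetric]) (simp add: v_def)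
    also have "\<dots> = det ?M \<cdot>\<^sub>v (sgn (det ?M) \<cdot>\<^sub>v v)"
      by (intro eq_vecI) (auto simp: v_def)
    also have "\<dots> = int m \<cdot>\<^sub>v v"
    proof -
      have "int m = \<bar>det ?M\<bar>" by (simp add: m_def)
      also have "\<dots> = det ?M * sgn (det ?M)" by (rule abs_sgn)
      finally show ?thesis by (simp only: smult_smult_assoc)
    qed
    also have "\<dots> = vec n (\<lambda>i. (int m \<cdot>\<^sub>v x) $ i)"
      using x by (intro eq_vecI) (auto simp: v_def)
    finally have "?M *\<^sub>v w = vec n (\<lambda>i. (int m \<cdot>\<^sub>v x) $ i)" .
    with w have "\<exists>y\<in>carrier_vec n. vec n (\<lambda>i. (int m \<cdot>\<^sub>v x) $ i) = ?M *\<^sub>v y"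
      by metis
    moreover have "int m \<cdot>\<^sub>v x \<in> carrier_vec (Suc n)" using x by simp
    moreover have "(\<Sum>i<Suc n. (int m \<cdot>\<^sub>v x) $ i) = 0" using sum[of m] x0 by simp
    ultimately have "int m \<cdot>\<^sub>v x \<in> mat_image (laplacian (cone_graph (circulant_graph n k s)))"
      using cone_laplacian_image_iff by blast
    with m show "\<exists>m::nat. m > 0 \<and> int m \<cdot>\<^sub>v x \<in> mat_image (laplacian (cone_graph (circulant_graph n k s)))"
      by blast
  qed
qed

section \<open>The monic polynomial of the graph and its companion matrix\<close>

lemma coeff_jump_poly:
  "coeff (jump_poly k s) j =
    (\<Sum>l = 1..k. (if j = s k + s l then 1 else 0) + (if j = s k - s l then 1 else 0)) -
    (if j = s k then int (2 * k + 1) else 0)"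
  unfolding jump_poly_def coeff_diff coeff_sum coeff_add coeff_monom by (simp only: eq_commute[of j])

text \<open>Only the largest jump, \<open>l = k\<close>, reaches the exponents 0 and
  \<open>2 * s k\<close>. The two values 1 are what \<open>companion_matrix_bimonic\<close> asks
  for.\<close>

lemma coeff_jump_poly_ends: "coeff (jump_poly k s) 0 = 1" "coeff (jump_poly k s) (2 * s k) = 1"
proof -
  have sk: "s k > 0" using jump_bounds(1)[of k] k by simp
  have low: "0 = s k + s l \<longleftrightarrow> False" "0 = s k - s l \<longleftrightarrow> l = k"
    and high: "2 * s k = s k + s l \<longleftrightarrow> l = k" "2 * s k = s k - s l \<longleftrightarrow> False" if "l \<in> {1..k}" for l
    using sk jump_bounds[OF that] jump_eq_iff[OF that, of k] k by auto
  have "coeff (jump_poly k s) 0 = (\<Sum>l = 1..k. if l = k then 1 else 0)"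
    unfolding coeff_jump_poly using sk by (simp add: low cong: sum.cong_simp)
  then show "coeff (jump_poly k s) 0 = 1" using k by simp
  have "coeff (jump_poly k s) (2 * s k) = (\<Sum>l = 1..k. if l = k then 1 else 0)"
    unfolding coeff_jump_poly using sk by (simp add: high cong: sum.cong_simp)
  then show "coeff (jump_poly k s) (2 * s k) = 1" using k by simp
qed

lemma degree_jump_poly: "degree (jump_poly k s) = 2 * s k"
proof (rule antisym[OF degree_le le_degree])
  show "\<forall>i>2 * s k. coeff (jump_poly k s) i = 0"
  proof (intro allI impI)
    fix i assume i: "i > 2 * s k"
    have "i \<noteq> s k + s l" "i \<noteq> s k - s l" if "l \<in> {1..k}" for l
      using i jump_bounds[OF that] by auto
    with i show "coeff (jump_poly k s) i = 0"
      unfolding coeff_jump_poly by (simp cong: sum.cong_simp)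
  qed
qed (simp add: coeff_jump_poly_ends)

text \<open>The Laurent polynomial is \<open>- z ^ (- s k)\<close> times
  \<open>jump_poly k s\<close>, which fits \<open>companion_matrix_bimonic\<close> with sign
  \<open>- 1\<close> and lowest exponent \<open>- s k\<close>.\<close>

lemma companion_matrix_jump:
  "companion_matrix (of_nat (2 * k + 1) - (\<Sum>l = 1..k. zpow (int (s l)) + zpow (- int (s l)))) =
    companion (jump_poly k s)"
proof -
  let ?Q = "of_nat (2 * k + 1) - (\<Sum>l = 1..k. zpow (int (s l)) + zpow (- int (s l)))"
  let ?P = "jump_poly k s"
  let ?R = "\<Sum>j\<le>2 * s k. Poly_Mapping.single (- int (s k) + int j) (- 1 * coeff ?P j)"
  have sk: "s k > 0" using jump_bounds(1)[of k] k by simp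
  have "?Q = ?R"
  proof (rule poly_mapping_eqI)
    fix e
    have Q: "Poly_Mapping.lookup ?Q e = (if e = 0 then int (2 * k + 1) else 0) -
      (\<Sum>l = 1..k. (if e = int (s l) then 1 else 0) + (if e = - int (s l) then 1 else 0))"
      unfolding lookup_minus lookup_sum lookup_add lookup_single lookup_of_nat when_def
      by (simp only: eq_commute[of e])
    have R: "Poly_Mapping.lookup ?R e =
       (\<Sum>j\<le>2 * s k. if j = nat (e + int (s k)) \<and> - int (s k) \<le> e then - coeff ?P j else 0)"
      unfolding lookup_sum by (intro sum.cong) (auto simp: lookup_single when_def)
    show "Poly_Mapping.lookup ?Q e = Poly_Mapping.lookup ?R e"
    proof (cases "- int (s k) \<le> e")
      case False
      then have "Poly_Mapping.lookup ?Q e = 0"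
      proof -
        have "e \<noteq> int (s l)" "e \<noteq> - int (s l)" if "l \<in> {1..k}" for l
          using False jump_bounds[OF that] by auto
        moreover have "e \<noteq> 0" using False by simp
        ultimately show ?thesis unfolding Q by (simp cong: sum.cong_simp)
      qed
      with False show ?thesis unfolding R by simp
    next
      case True
      define j where "j = nat (e + int (s k))"
      have e: "e = int j - int (s k)" using True by (simp add: j_def)
      have "Poly_Mapping.lookup ?R e = (if j \<le> 2 * s k then - coeff ?P j else 0)"
        unfolding R j_def[symmetric] using True by simp
      also have "\<dots> = - coeff ?P j"
        using coeff_eq_0[of ?P j] by (simp add: degree_jump_poly)
      also have "\<dots> = Poly_Mapping.lookup ?Q e"
      proof -
        have "(\<Sum>l = 1..k. (if j = s k + s l then 1 else 0) + (if j = s k - s l then 1 else 0)) =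
          (\<Sum>l = 1..k. (if e = int (s l) then 1 else 0) + (if e = - int (s l) then 1 else (0::int)))"
        proof (intro sum.cong refl)
          fix l assume "l \<in> {1..k}"
          \<comment> \<open>This bound makes the natural number \<open>s k - s l\<close> a true
            difference, so exponents can be compared over the integers.\<close>
          then have "s l \<le> s k" by (rule jump_bounds)
          then have "j = s k + s l \<longleftrightarrow> e = int (s l)" "j = s k - s l \<longleftrightarrow> e = - int (s l)"
            unfolding e by auto
          then show "(if j = s k + s l then 1 else 0) + (if j = s k - s l then 1 else 0) =
            (if e = int (s l) then 1 else 0) + (if e = - int (s l) then 1 else (0::int))" by simp
        qed
        moreover have "j = s k \<longleftrightarrow> e = 0" unfolding e by simp
        ultimately show ?thesis unfolding Q coeff_jump_poly by simp
      qed
      finally show ?thesis ..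
    qed
  qed
  then show ?thesis
    using companion_matrix_bimonic[of "- 1" "2 * s k" "coeff ?P" "- int (s k)"] sk
    by (simp only: companion_def Let_def degree_jump_poly coeff_jump_poly_ends) simp
qed

text \<open>After the shift by \<open>s k\<close> the exponents cancel modulo \<open>n\<close>
  crosswise: the backward jump \<open>n - s l\<close> meets \<open>s k + s l\<close>, and the
  forward jump \<open>s l\<close> meets \<open>s k - s l\<close>.\<close>

lemma jump_poly_circ_poly:
  "(monom 1 n - 1) dvd
    monom 1 (s k) * circ_poly n (jump_set n k s) (int (2 * k + 1)) + jump_poly k s"
proof -
  have "monom 1 (s k) * circ_poly n (jump_set n k s) (int (2 * k + 1)) =
    monom (int (2 * k + 1)) (s k) - (\<Sum>l = 1..k. monom 1 (s k + (n - s l)) + monom 1 (s k + (n - (n - s l))))"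
    unfolding circ_poly_def sum_jump_set right_diff_distrib sum_distrib_left distrib_left mult_monom
    by (simp add: smult_monom)
  then have "monom 1 (s k) * circ_poly n (jump_set n k s) (int (2 * k + 1)) + jump_poly k s =
     (\<Sum>l = 1..k. (monom 1 (s k + s l) - monom 1 (s k + (n - (n - s l)))) +
        (monom 1 (s k - s l) - monom 1 (s k + (n - s l))))"
    by (simp add: jump_poly_def sum_subtractf sum.distrib)
  also have "(monom 1 n - 1) dvd \<dots>"
  proof (intro dvd_sum dvd_add dvd_monom_diff_mod)
    fix l assume l: "l \<in> {1..k}"
    show "(s k + s l) mod n = (s k + (n - (n - s l))) mod n" using jump_less[OF l] by simp
    have "s k + (n - s l) = (s k - s l) + n" using jump_less[OF l] jump_bounds[OF l] by simp
    then show "(s k - s l) mod n = (s k + (n - s l)) mod n" by simp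
  qed
  finally show ?thesis .
qed

section \<open>Assembling the isomorphism\<close>

lemma Jac_cone_circulant_iso:
  "Jac (cone_graph (circulant_graph n k s)) \<cong>
    coker (companion (jump_poly k s) ^\<^sub>m n - 1\<^sub>m (degree (jump_poly k s)))"
proof -
  let ?L = "laplacian (cone_graph (circulant_graph n k s))"
  let ?P = "jump_poly k s"
  let ?d = "degree ?P"
  let ?B = "companion ?P ^\<^sub>m n - 1\<^sub>m ?d"
  let ?V = "monoid_vec TYPE(int) (Suc n)" and ?W = "monoid_vec TYPE(int) ?d"
  have sk: "s k > 0" using jump_bounds(1)[of k] k by simp
  have monic: "lead_coeff ?P = 1" and d: "?d > 0" "?d < n"
    using sk less by (simp_all add: degree_jump_poly coeff_jump_poly_ends)
  have B: "dim_row ?B = ?d" "dim_col ?B = ?d" by auto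
  define K :: "int vec set" where "K = {x \<in> carrier_vec (Suc n). (\<Sum>i<Suc n. x $ i) = 0}"
  define \<phi> where "\<phi> x = krylov ?P (vec_poly n x)" for x
  \<comment> \<open>The map on representatives: forget the apex coordinate, read the rest as a
    polynomial, evaluate it at the companion matrix and take the coset.\<close>
  define h where "h x = mat_image ?B #>\<^bsub>?W\<^esub> \<phi> x" for x
  interpret V: comm_group ?V by (rule comm_group_vec)
  interpret W: comm_group ?W by (rule comm_group_vec)
  have sub: "subgroup (mat_image ?B) ?W" using subgroup_mat_image[of ?B] by (simp only: B)
  interpret normal "mat_image ?B" ?W using W.normal_iff_subgroup sub by simp
  have coker: "coker ?B = ?W Mod mat_image ?B" unfolding coker_def B ..
  have \<phi>: "\<phi> x \<in> carrier_vec ?d" for x by (simp add: \<phi>_def)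
  have inv: "inv\<^bsub>?V\<^esub> x = - x" if "x \<in> carrier_vec (Suc n)" for x
    using that by (intro V.inv_equality) (auto simp: monoid_vec_simps)
  have "torsion_group (?V Mod mat_image ?L) \<cong> coker ?B"
  proof (rule torsion_Mod_iso[where K = K and h = h])
    show "comm_group ?V" by (rule comm_group_vec)
    show "subgroup (mat_image ?L) ?V"
      using subgroup_mat_image[of ?L] carrier_matD[OF cone_laplacian_carrier] by simp
    then have imV: "mat_image ?L \<subseteq> carrier_vec (Suc n)"
      by (metis subgroup.subset monoid_vec_simps(2))
    then show "mat_image ?L \<subseteq> K" using cone_laplacian_image_iff by (auto simp: K_def)
    show "subgroup K ?V"
    proof (rule V.subgroupI)
      show "K \<noteq> {}" unfolding K_def by (auto intro!: exI[of _ "0\<^sub>v (Suc n)"])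
    qed (auto simp: K_def monoid_vec_simps inv sum.distrib sum_negf)
    show "group (coker ?B)" using comm_group_coker by (simp add: comm_group_def)
    have "\<phi> \<in> hom ?V ?W"
      by (rule homI) (auto simp: monoid_vec_simps \<phi>_def vec_poly_add[of _ "Suc n"] krylov_add)
    then show "h \<in> hom ?V (coker ?B)"
      using hom_compose[OF _ r_coset_hom_Mod] unfolding coker h_def comp_def by blast
    show "h ` K = carrier (coker ?B)"
    proof (intro equalityI subsetI)
      show "C \<in> carrier (coker ?B)" if "C \<in> h ` K" for C
        using that \<phi> by (auto simp: coker carrier_FactGroup h_def monoid_vec_simps)
    next
      fix C assume "C \<in> carrier (coker ?B)"
      then obtain w where w: "w \<in> carrier_vec ?d" "C = mat_image ?B #>\<^bsub>?W\<^esub> w"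
        by (auto simp: coker carrier_FactGroup monoid_vec_simps)
      let ?f = "krylov_inv ?P w"
      \<comment> \<open>The apex entry is chosen to make the coordinate sum 0. The polynomial has
        degree below \<open>2 * s k < n\<close>, so its coefficients fit into the first
        \<open>n\<close> entries.\<close>
      define x where "x = vec (Suc n) (\<lambda>i. if i < n then coeff ?f i else - (\<Sum>i<n. coeff ?f i))"
      have "x \<in> K" by (simp add: K_def x_def)
      have "degree ?f < n" using degree_krylov_inv[OF monic d(1)] d(2) by (rule less_trans)
      then have "vec_poly n x = ?f"
        by (auto simp: poly_eq_iff coeff_vec_poly x_def intro!: coeff_eq_0)
      then have "\<phi> x = w" by (simp add: \<phi>_def krylov_krylov_inv[OF monic d(1) w(1)])
      with \<open>x \<in> K\<close> w(2) show "C \<in> h ` K" by (auto simp: h_def)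
    qed
  next
    fix x assume "x \<in> K"
    then have x: "x \<in> carrier_vec (Suc n)" "(\<Sum>i<Suc n. x $ i) = 0" by (auto simp: K_def)
    \<comment> \<open>The kernel is carried from the image of \<open>?B\<close> to the ideal of
      \<open>?P\<close> and \<open>X ^ n - 1\<close>, then to that of \<open>circ_poly\<close> and
      \<open>X ^ n - 1\<close>, and back to the image of the Laplacian.\<close>
    have "h x = \<one>\<^bsub>coker ?B\<^esub> \<longleftrightarrow> \<phi> x \<in> mat_image ?B"
      using W.coset_join1[OF _ _ sub] W.coset_join2[OF _ sub] \<phi>[of x]
      unfolding h_def coker one_FactGroup monoid_vec_simps by blast
    also have "\<dots> \<longleftrightarrow> (\<exists>w\<in>carrier_vec ?d. \<phi> x = ?B *\<^sub>v w)"
      unfolding mat_image_def B by blast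
    also have "\<dots> \<longleftrightarrow> (\<exists>g h. vec_poly n x = ?P * g + (monom 1 n - 1) * h)"
      unfolding \<phi>_def by (rule krylov_in_image_iff[OF monic d(1)])
    also have "\<dots> \<longleftrightarrow> (\<exists>g h. vec_poly n x =
        circ_poly n (jump_set n k s) (int (2 * k + 1)) * g + (monom 1 n - 1) * h)"
      by (rule ideal_cong[OF n_pos jump_poly_circ_poly])
    also have "vec_poly n x = vec_poly n (vec n (\<lambda>i. x $ i))"
      by (simp add: poly_eq_iff coeff_vec_poly)
    also have "(\<exists>g h. vec_poly n (vec n (\<lambda>i. x $ i)) =
        circ_poly n (jump_set n k s) (int (2 * k + 1)) * g + (monom 1 n - 1) * h) \<longleftrightarrow>
      x \<in> mat_image ?L"
      using cone_laplacian_image_iff[OF x(1)] x(2)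
        circ_mat_image_iff[OF n_pos _ jump_set_subset, of "vec n (\<lambda>i. x $ i)"] by simp
    finally show "h x = \<one>\<^bsub>coker ?B\<^esub> \<longleftrightarrow> x \<in> mat_image ?L" .
  next
    fix x assume "x \<in> carrier ?V"
    then have x: "x \<in> carrier_vec (Suc n)" by (simp add: monoid_vec_simps)
    show "(\<exists>m::nat. m > 0 \<and> x [^]\<^bsub>?V\<^esub> m \<in> mat_image ?L) \<longleftrightarrow> x \<in> K"
      unfolding pow_monoid_vec[OF x] cone_torsion_iff[OF x] using x by (simp add: K_def)
  qed
  then show ?thesis
    unfolding Jac_def coker_def[of ?L] carrier_matD(1)[OF cone_laplacian_carrier] .
qed

end

theorem theorem3:
  fixes n k :: nat and s :: "nat \<Rightarrow> nat" and Q :: laurent_poly and A :: "int mat"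
  assumes "k \<ge> 1"
    and "1 \<le> s 1"
    and "strict_mono_on {1..k} s"
    and "real (s k) < real n / 2"
  defines "Q \<equiv> of_nat (2 * k + 1) - (\<Sum>l = 1..k. zpow (int (s l)) + zpow (- int (s l)))"
    and "A \<equiv> companion_matrix Q"
  shows "Jac (cone_graph (circulant_graph n k s)) \<cong> coker (A ^\<^sub>m n - 1\<^sub>m (dim_row A))"
proof -
  have less: "2 * s k < n" using assms(4) by linarith
  have "A = companion (jump_poly k s)"
    unfolding A_def Q_def by (rule companion_matrix_jump[OF assms(1-3) less])
  then show ?thesis using Jac_cone_circulant_iso[OF assms(1-3) less] by simp
qed

end
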